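(* Let $n\ge 1$, let $\Omega\subset\mathbb{R}^n$ be a bounded connected open set, let $\bar x\in\Omega$, and let $F\in C^0(\Omega\times\mathbb{R}\times\mathbb{R}^n\times\mathcal{S}^{n\times n})$. Assume that $u\in LSC(\Omega)$ is lowerconical at $\bar x$ and satisfies, for some $f\in USC(\Omega)$, $$F(x,u,\nabla u,\nabla^2u)\le f(x)\quad\text{in }\Omega\setminus\{\bar x\}\text{ in the viscosity sense}.$$ Then $$F(x,u,\nabla u,\nabla^2u)\le f(x)\quad\text{in }\Omega\text{ in the viscosity sense}.$$
   Context: $\mathcal{S}^{n\times n}$ is the set of real symmetric $n\times n$ matrices. $LSC(\Omega)$ and $USC(\Omega)$ are the sets of (real-valued) lower-semicontinuous and upper-semicontinuous functions on $\Omega$. Lowerconical: a function $u\in LSC(\Omega)$ with $\inf_\Omega u>-\infty$ is lowerconical at a point $\bar x\in\Omega$ if for every $\eta\in C^\infty(\Omega)$ and every $\epsilon>0$, $$\inf_{x\in\Omega}\Big((u+\eta)(x)-(u+\eta)(\bar x)-\epsilon|x-\bar x|\Big)<0.$$ Viscosity sense: for an open set $U$ and $u\in LSC(U)$, "$F(x,u,\nabla u,\nabla^2u)\le f(x)$ in $U$ in the viscosity sense" means: whenever $x_0\in U$ and $\varphi$ is a $C^2$ function near $x_0$ with $\varphi\le u$ near $x_0$ and $\varphi(x_0)=u(x_0)$, one has $F(x_0,\varphi(x_0),\nabla\varphi(x_0),\nabla^2\varphi(x_0))\le f(x_0)$. *)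

theory Defs
  imports "HOL-Analysis.Analysis"
begin

text \<open>Functions on a set are total functions constrained only on that set. Every definition below
  depends only on the values on the (open) set in question.\<close>

definition lsc_on :: "'a::topological_space set \<Rightarrow> ('a \<Rightarrow> real) \<Rightarrow> bool" where
  "lsc_on S f \<longleftrightarrow> (\<forall>x\<in>S. \<forall>c. c < f x \<longrightarrow> (\<forall>\<^sub>F y in at x within S. c < f y))"

definition usc_on :: "'a::topological_space set \<Rightarrow> ('a \<Rightarrow> real) \<Rightarrow> bool" where
  "usc_on S f \<longleftrightarrow> (\<forall>x\<in>S. \<forall>c. f x < c \<longrightarrow> (\<forall>\<^sub>F y in at x within S. f y < c))"

text \<open>Meaningful only where \<open>f\<close> is differentiable; there it is the usual partial derivative.\<close>

definition partial_deriv :: "'n::finite \<Rightarrow> (real^'n \<Rightarrow> real) \<Rightarrow> real^'n \<Rightarrow> real" where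
  "partial_deriv i f x = frechet_derivative f (at x) (axis i 1)"

definition grad :: "(real^'n::finite \<Rightarrow> real) \<Rightarrow> real^'n \<Rightarrow> real^'n" where
  "grad f x = (\<chi> i. partial_deriv i f x)"

definition hessian :: "(real^'n::finite \<Rightarrow> real) \<Rightarrow> real^'n \<Rightarrow> real^'n^'n" where
  "hessian f x = (\<chi> i j. partial_deriv i (partial_deriv j f) x)"

text \<open>\<open>C\<^sup>k\<close> on an open set. The recursion asks for Frechet differentiability as well as for the
  partial derivatives to be \<open>C\<^sup>k\<close>; since a function with continuous partial derivatives on an open
  set is Frechet differentiable, this is the usual class defined by continuous partial derivatives
  up to order \<open>k\<close>.\<close>

fun Ck_on :: "nat \<Rightarrow> (real^'n::finite) set \<Rightarrow> (real^'n \<Rightarrow> real) \<Rightarrow> bool" where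
  "Ck_on 0 S f \<longleftrightarrow> continuous_on S f"
| "Ck_on (Suc k) S f \<longleftrightarrow> (\<forall>x\<in>S. f differentiable (at x)) \<and> (\<forall>i. Ck_on k S (partial_deriv i f))"

definition smooth_fun_on :: "(real^'n::finite) set \<Rightarrow> (real^'n \<Rightarrow> real) \<Rightarrow> bool" where
  "smooth_fun_on S f \<longleftrightarrow> (\<forall>k. Ck_on k S f)"

definition sym_matrices :: "(real^'n::finite^'n) set" where
  "sym_matrices = {A. transpose A = A}"

text \<open>The infima are taken in the extended reals: \<open>\<eta>\<close> may be unbounded below on \<open>\<Omega>\<close>, in which
  case the infimum in the last condition is \<open>-\<infinity>\<close>.\<close>

definition lowerconical_at :: "(real^'n::finite) set \<Rightarrow> (real^'n \<Rightarrow> real) \<Rightarrow> real^'n \<Rightarrow> bool" where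
  "lowerconical_at \<Omega> u a \<longleftrightarrow>
     lsc_on \<Omega> u \<and> (INF x\<in>\<Omega>. ereal (u x)) > -\<infinity> \<and> a \<in> \<Omega> \<and>
     (\<forall>\<eta> \<epsilon>. smooth_fun_on \<Omega> \<eta> \<longrightarrow> \<epsilon> > 0 \<longrightarrow>
        (INF x\<in>\<Omega>. ereal ((u x + \<eta> x) - (u a + \<eta> a) - \<epsilon> * norm (x - a))) < 0)"

definition visc_supersol ::
  "(real^'n::finite) set \<Rightarrow> (real^'n \<Rightarrow> real \<Rightarrow> real^'n \<Rightarrow> real^'n^'n \<Rightarrow> real)
     \<Rightarrow> (real^'n \<Rightarrow> real) \<Rightarrow> (real^'n \<Rightarrow> real) \<Rightarrow> bool" where
  "visc_supersol U F f u \<longleftrightarrow>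
     (\<forall>x\<^sub>0 \<phi>. x\<^sub>0 \<in> U
        \<longrightarrow> (\<exists>V. open V \<and> x\<^sub>0 \<in> V \<and> Ck_on 2 V \<phi>)
        \<longrightarrow> (\<forall>\<^sub>F x in nhds x\<^sub>0. \<phi> x \<le> u x)
        \<longrightarrow> \<phi> x\<^sub>0 = u x\<^sub>0
        \<longrightarrow> F x\<^sub>0 (\<phi> x\<^sub>0) (grad \<phi> x\<^sub>0) (hessian \<phi> x\<^sub>0) \<le> f x\<^sub>0)"

end

theory Submission
  imports Defs
begin

text \<open>
  Away from \<open>a\<close> the claim is the hypothesis, so let \<open>\<phi>\<close> be a \<open>C\<^sup>2\<close> function touching \<open>u\<close> from below
  at \<open>a\<close>. The idea is to move the contact point off \<open>a\<close>, where the inequality is known, by a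
  perturbation of \<open>\<phi>\<close> that is small in \<open>C\<^sup>2\<close>, and then to pass to the limit.

  Fix a small \<open>d > 0\<close> and tilt the strictly touching function \<open>\<phi> - d |x - a|\<^sup>2\<close> by a linear function
  \<open>p \<bullet> (x - a)\<close> with \<open>|p| \<le> d\<^sup>2\<close>. If for every such \<open>p\<close> the tilted function stayed below \<open>u\<close> near
  \<open>a\<close>, then, taking for each \<open>x\<close> the vector \<open>p\<close> of length \<open>d\<^sup>2\<close> in the direction of \<open>x - a\<close>, one would
  get \<open>u \<ge> \<phi> - d |x - a|\<^sup>2 + d\<^sup>2 |x - a|\<close>, so \<open>u\<close> would have an upward cone at \<open>a\<close> on top of a
  differentiable function. That is what being lowerconical excludes
  (\<open>lowerconical_no_cone_above_test\<close>). Hence for some \<open>p\<close> the difference between \<open>u\<close> and the tilted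
  function is negative somewhere; its minimum over a small ball is attained because \<open>u\<close> is lower
  semicontinuous, at a point other than \<open>a\<close> because the difference vanishes at \<open>a\<close>, and within
  distance \<open>d\<close> of \<open>a\<close> because farther out the quadratic term beats the linear one
  (\<open>tilted_contact_point\<close>).

  At the contact point \<open>x\<close> the equation gives \<open>F (x, u(x), \<nabla>\<phi>(x) + O(d\<^sup>2), \<nabla>\<^sup>2\<phi>(x) - 2d I) \<le> f(x)\<close>,
  and \<open>u(x) \<rightarrow> \<phi>(a)\<close> since \<open>\<phi>(x) \<le> u(x) \<le> \<phi>(x) + d\<^sup>3\<close>. Letting \<open>d \<rightarrow> 0\<close> and using that \<open>F\<close> is
  continuous and \<open>f\<close> upper semicontinuous gives the inequality at \<open>a\<close>. As \<open>F\<close> is continuous on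
  symmetric matrices only, this step also needs the symmetry of second derivatives
  (\<open>hessian_symmetric\<close>).
\<close>

section \<open>Partial derivatives and the classes \<open>C\<^sup>k\<close>\<close>

lemma has_derivative_imp_partial_deriv:
  assumes "(f has_derivative f') (at x)"
  shows "partial_deriv i f x = f' (axis i 1)"
  using frechet_derivative_at[OF assms] by (simp add: partial_deriv_def)

lemma partial_deriv_add:
  assumes "f differentiable (at x)" "g differentiable (at x)"
  shows "partial_deriv i (\<lambda>y. f y + g y) x = partial_deriv i f x + partial_deriv i g x"
  using has_derivative_imp_partial_deriv[OF has_derivative_add
      [OF assms[unfolded frechet_derivative_works]]]
  by (simp add: partial_deriv_def)

lemma partial_deriv_cong_open:
  assumes "open S" "x \<in> S" "\<And>y. y \<in> S \<Longrightarrow> f y = g y" "f differentiable (at x)"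
  shows "partial_deriv i f x = partial_deriv i g x"
  using frechet_derivative_transform_within_open[OF assms(4,1,2,3)]
  by (simp add: partial_deriv_def)

lemma partial_deriv_along_axis:
  assumes "f differentiable (at (x + s *\<^sub>R axis i 1))"
  shows "((\<lambda>s. f (x + s *\<^sub>R axis i 1)) has_real_derivative
           partial_deriv i f (x + s *\<^sub>R axis i 1)) (at s)"
proof -
  let ?f' = "frechet_derivative f (at (x + s *\<^sub>R axis i 1))"
  have f': "(f has_derivative ?f') (at (x + s *\<^sub>R axis i 1))"
    using assms frechet_derivative_works by blast
  then have "linear ?f'"
    using has_derivative_linear by blast
  have "((\<lambda>s. f (x + s *\<^sub>R axis i 1)) has_derivative (\<lambda>h. ?f' (h *\<^sub>R axis i 1))) (at s)"
    by (rule has_derivative_compose[where f = "\<lambda>s. x + s *\<^sub>R axis i 1" and f' = "\<lambda>h. h *\<^sub>R axis i 1", OF _ f'])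
      (auto intro!: derivative_eq_intros)
  then show ?thesis
    by (simp add: has_field_derivative_def partial_deriv_def linear_cmul[OF \<open>linear ?f'\<close>] mult_commute_abs)
qed

lemma Ck_on_cong_open:
  assumes "open S" "\<And>x. x \<in> S \<Longrightarrow> f x = g x" "Ck_on k S f"
  shows "Ck_on k S g"
  using assms(2,3)
proof (induction k arbitrary: f g)
  case 0
  then show ?case by (simp cong: continuous_on_cong)
next
  case (Suc k)
  have "g differentiable (at x)" if "x \<in> S" for x
  proof -
    have "f differentiable (at x)"
      using Suc.prems(2) that by simp
    then show ?thesis
      using has_derivative_transform_within_open[where f = f and g = g and t = UNIV, OF _ \<open>open S\<close> that Suc.prems(1)]
      unfolding differentiable_def by blast
  qed
  moreover have "Ck_on k S (partial_deriv i g)" for i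
  proof (rule Suc.IH)
    show "Ck_on k S (partial_deriv i f)"
      using Suc.prems by simp
    show "partial_deriv i f x = partial_deriv i g x" if "x \<in> S" for x
      using Suc.prems that by (intro partial_deriv_cong_open[OF \<open>open S\<close>]) auto
  qed
  ultimately show ?case by simp
qed

lemma Ck_on_add:
  assumes "open S" "Ck_on k S f" "Ck_on k S g"
  shows "Ck_on k S (\<lambda>x. f x + g x)"
  using assms(2,3)
proof (induction k arbitrary: f g)
  case 0
  then show ?case by (simp add: continuous_on_add)
next
  case (Suc k)
  have "Ck_on k S (partial_deriv i (\<lambda>x. f x + g x))" for i
  proof (rule Ck_on_cong_open[OF \<open>open S\<close>])
    show "Ck_on k S (\<lambda>x. partial_deriv i f x + partial_deriv i g x)"
      using Suc by simp
  qed (use Suc.prems in \<open>simp add: partial_deriv_add\<close>)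
  then show ?case
    using Suc.prems by (simp add: differentiable_add)
qed

lemma C2_onD:
  assumes "Ck_on 2 V f"
  shows "\<And>x. x \<in> V \<Longrightarrow> f differentiable (at x)"
    and "\<And>i x. x \<in> V \<Longrightarrow> partial_deriv i f differentiable (at x)"
    and "\<And>i j. continuous_on V (partial_deriv i (partial_deriv j f))"
  using assms by (auto simp: numeral_2_eq_2)

lemma C2_continuous_on:
  assumes "Ck_on 2 V f"
  shows "continuous_on V f" "continuous_on V (grad f)" "continuous_on V (hessian f)"
proof -
  show "continuous_on V f"
    by (rule differentiable_imp_continuous_on)
      (use C2_onD(1)[OF assms] in \<open>auto simp: differentiable_on_def intro: differentiable_at_withinI\<close>)
  have "continuous_on V (partial_deriv i f)" for i
    by (rule differentiable_imp_continuous_on)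
      (use C2_onD(2)[OF assms] in \<open>auto simp: differentiable_on_def intro: differentiable_at_withinI\<close>)
  then show "continuous_on V (grad f)"
    unfolding grad_def by (intro continuous_on_vec_lambda)
  show "continuous_on V (hessian f)"
    unfolding hessian_def by (intro continuous_on_vec_lambda C2_onD(3)[OF assms])
qed

section \<open>Symmetry of the Hessian\<close>

text \<open>The mean value theorem, applied first in the direction \<open>i\<close> to a difference in the direction \<open>j\<close>
  and then in the direction \<open>j\<close>. The left-hand side is symmetric in \<open>i\<close> and \<open>j\<close>, the right-hand side
  is a mixed derivative in a fixed order: this is the source of the symmetry of the Hessian.\<close>

lemma second_difference_eq_mixed_partial:
  assumes f: "Ck_on 2 V f" and V: "cball x (2 * h) \<subseteq> V" and "0 < h"
  shows "\<exists>y\<in>cball x (2 * h).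
    f (x + h *\<^sub>R axis i 1 + h *\<^sub>R axis j 1) - f (x + h *\<^sub>R axis i 1) - f (x + h *\<^sub>R axis j 1) + f x
      = h\<^sup>2 * partial_deriv j (partial_deriv i f) y"
proof -
  have near: "x + s *\<^sub>R axis i 1 + t *\<^sub>R axis j 1 \<in> cball x (2 * h)"
    if "0 \<le> s" "s \<le> h" "0 \<le> t" "t \<le> h" for s t
  proof -
    have "norm (s *\<^sub>R axis i 1 + t *\<^sub>R axis j (1::real)) \<le> 2 * h"
      using norm_triangle_ineq[of "s *\<^sub>R axis i 1" "t *\<^sub>R axis j (1::real)"] that
      by simp
    then show ?thesis
      by (metis add.assoc add_diff_cancel_left' dist_commute dist_norm mem_cball)
  qed
  define g where
    "g s = f ((x + h *\<^sub>R axis j 1) + s *\<^sub>R axis i 1) - f (x + s *\<^sub>R axis i 1)" for s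
  have "\<exists>s. 0 < s \<and> s < h \<and> g h - g 0 = (h - 0) *
    (partial_deriv i f ((x + h *\<^sub>R axis j 1) + s *\<^sub>R axis i 1) - partial_deriv i f (x + s *\<^sub>R axis i 1))"
  proof (rule MVT2[OF \<open>0 < h\<close>])
    fix s assume s: "0 \<le> s" "s \<le> h"
    have "(x + h *\<^sub>R axis j 1) + s *\<^sub>R axis i 1 \<in> V" "x + s *\<^sub>R axis i 1 \<in> V"
      using near[of s h] near[of s 0] s V \<open>0 < h\<close> by (auto simp: add_ac)
    then show "(g has_real_derivative partial_deriv i f ((x + h *\<^sub>R axis j 1) + s *\<^sub>R axis i 1)
        - partial_deriv i f (x + s *\<^sub>R axis i 1)) (at s)"
      unfolding g_def
      by (intro DERIV_diff partial_deriv_along_axis C2_onD(1)[OF f])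
  qed
  then obtain s where s: "0 < s" "s < h" and gs: "g h - g 0 = h *
    (partial_deriv i f ((x + h *\<^sub>R axis j 1) + s *\<^sub>R axis i 1) - partial_deriv i f (x + s *\<^sub>R axis i 1))"
    by auto
  have "\<exists>t. 0 < t \<and> t < h \<and>
    partial_deriv i f ((x + s *\<^sub>R axis i 1) + h *\<^sub>R axis j 1)
      - partial_deriv i f ((x + s *\<^sub>R axis i 1) + 0 *\<^sub>R axis j 1)
    = (h - 0) * partial_deriv j (partial_deriv i f) ((x + s *\<^sub>R axis i 1) + t *\<^sub>R axis j 1)"
  proof (rule MVT2[OF \<open>0 < h\<close>])
    fix t assume "0 \<le> t" "t \<le> h"
    then have "(x + s *\<^sub>R axis i 1) + t *\<^sub>R axis j 1 \<in> V"
      using near[of s t] s V by auto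
    then show "((\<lambda>t. partial_deriv i f ((x + s *\<^sub>R axis i 1) + t *\<^sub>R axis j 1)) has_real_derivative
        partial_deriv j (partial_deriv i f) ((x + s *\<^sub>R axis i 1) + t *\<^sub>R axis j 1)) (at t)"
      by (intro partial_deriv_along_axis C2_onD(2)[OF f])
  qed
  then obtain t where t: "0 < t" "t < h" and pt:
    "partial_deriv i f ((x + s *\<^sub>R axis i 1) + h *\<^sub>R axis j 1) - partial_deriv i f (x + s *\<^sub>R axis i 1)
      = h * partial_deriv j (partial_deriv i f) ((x + s *\<^sub>R axis i 1) + t *\<^sub>R axis j 1)"
    by auto
  show ?thesis
  proof (rule bexI)
    show "f (x + h *\<^sub>R axis i 1 + h *\<^sub>R axis j 1) - f (x + h *\<^sub>R axis i 1) - f (x + h *\<^sub>R axis j 1) + f x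
      = h\<^sup>2 * partial_deriv j (partial_deriv i f) ((x + s *\<^sub>R axis i 1) + t *\<^sub>R axis j 1)"
      using gs pt by (simp add: g_def add_ac power2_eq_square)
    show "(x + s *\<^sub>R axis i 1) + t *\<^sub>R axis j 1 \<in> cball x (2 * h)"
      using near s t by simp
  qed
qed

lemma tendsto_of_shrinking_cballs:
  fixes X :: "nat \<Rightarrow> 'a::metric_space"
  assumes "\<And>n. X n \<in> cball a (d n)" "d \<longlonglongrightarrow> 0"
  shows "X \<longlonglongrightarrow> a"
proof (rule metric_tendsto_imp_tendsto[OF assms(2)])
  show "\<forall>\<^sub>F n in sequentially. dist (X n) a \<le> dist (d n) 0"
    using assms(1) by (auto simp: dist_commute intro!: always_eventually order_trans[OF _ abs_ge_self])
qed

text \<open>For every small \<open>h\<close> the two mixed derivatives agree when each is evaluated at a suitable point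
  within \<open>2 h\<close> of \<open>x\<close>; continuity gives equality at \<open>x\<close> as \<open>h\<close> tends to zero.\<close>

lemma mixed_partials_eq:
  assumes f: "Ck_on 2 V f" and "open V" "x \<in> V"
  shows "partial_deriv i (partial_deriv j f) x = partial_deriv j (partial_deriv i f) x"
proof -
  obtain r where r: "0 < r" "cball x r \<subseteq> V"
    using \<open>open V\<close> \<open>x \<in> V\<close> open_contains_cball by blast
  define h where "h n = r / (2 * real (Suc n))" for n
  have h: "0 < h n" "cball x (2 * h n) \<subseteq> V" for n
  proof -
    show "0 < h n" using r by (simp add: h_def)
    have "2 * h n \<le> r" using r by (simp add: h_def field_simps)
    then show "cball x (2 * h n) \<subseteq> V" using r subset_cball by blast
  qed
  have "\<exists>y z. y \<in> cball x (2 * h n) \<and> z \<in> cball x (2 * h n) \<and>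
      partial_deriv i (partial_deriv j f) y = partial_deriv j (partial_deriv i f) z" for n
  proof -
    obtain y where y: "y \<in> cball x (2 * h n)"
      "f (x + h n *\<^sub>R axis j 1 + h n *\<^sub>R axis i 1) - f (x + h n *\<^sub>R axis j 1)
        - f (x + h n *\<^sub>R axis i 1) + f x = (h n)\<^sup>2 * partial_deriv i (partial_deriv j f) y"
      using second_difference_eq_mixed_partial[OF f h(2) h(1)] by blast
    obtain z where z: "z \<in> cball x (2 * h n)"
      "f (x + h n *\<^sub>R axis i 1 + h n *\<^sub>R axis j 1) - f (x + h n *\<^sub>R axis i 1)
        - f (x + h n *\<^sub>R axis j 1) + f x = (h n)\<^sup>2 * partial_deriv j (partial_deriv i f) z"
      using second_difference_eq_mixed_partial[OF f h(2) h(1)] by blast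
    have comm: "x + h n *\<^sub>R axis j 1 + h n *\<^sub>R axis i 1 = x + h n *\<^sub>R axis i 1 + h n *\<^sub>R axis j 1"
      by (simp add: add_ac)
    have "(h n)\<^sup>2 * partial_deriv i (partial_deriv j f) y
        = (h n)\<^sup>2 * partial_deriv j (partial_deriv i f) z"
      using y(2)[unfolded comm] z(2) by linarith
    then have "partial_deriv i (partial_deriv j f) y = partial_deriv j (partial_deriv i f) z"
      using h(1)[of n] by simp
    then show ?thesis
      using y(1) z(1) by blast
  qed
  then obtain Y Z where Y: "\<And>n. Y n \<in> cball x (2 * h n)" and Z: "\<And>n. Z n \<in> cball x (2 * h n)"
    and YZ: "\<And>n. partial_deriv i (partial_deriv j f) (Y n) = partial_deriv j (partial_deriv i f) (Z n)"
    by metis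
  have "(\<lambda>n. r * inverse (real (Suc n))) \<longlonglongrightarrow> r * 0"
    by (intro tendsto_intros LIMSEQ_inverse_real_of_nat)
  moreover have "r * inverse (real (Suc n)) = 2 * h n" for n
    by (simp add: h_def field_simps)
  ultimately have h0: "(\<lambda>n. 2 * h n) \<longlonglongrightarrow> 0"
    by simp
  have lim: "(\<lambda>n. g (W n)) \<longlonglongrightarrow> g x"
    if W: "\<And>n. W n \<in> cball x (2 * h n)" and g: "continuous_on V g" for W and g :: "_ \<Rightarrow> real"
  proof (rule continuous_on_tendsto_compose[OF g _ \<open>x \<in> V\<close>])
    show "W \<longlonglongrightarrow> x"
      by (rule tendsto_of_shrinking_cballs[OF W h0])
    show "\<forall>\<^sub>F n in sequentially. W n \<in> V"
      using W h(2) by (intro always_eventually allI) blast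
  qed
  have "(\<lambda>n. partial_deriv i (partial_deriv j f) (Y n)) \<longlonglongrightarrow> partial_deriv i (partial_deriv j f) x"
    by (rule lim[OF Y C2_onD(3)[OF f]])
  moreover have "(\<lambda>n. partial_deriv j (partial_deriv i f) (Z n)) \<longlonglongrightarrow> partial_deriv j (partial_deriv i f) x"
    by (rule lim[OF Z C2_onD(3)[OF f]])
  ultimately show ?thesis
    unfolding YZ by (rule LIMSEQ_unique)
qed

lemma hessian_symmetric:
  assumes "Ck_on 2 V f" "open V" "x \<in> V"
  shows "hessian f x \<in> sym_matrices"
  using mixed_partials_eq[OF assms]
  by (simp add: sym_matrices_def transpose_def hessian_def vec_eq_iff)

section \<open>Quadratic perturbations\<close>

text \<open>One family serves for the tilts of the test function (\<open>K = - d\<close>) and for the function \<open>\<eta>\<close> in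
  the definition of a lowerconical function (\<open>K\<close> large). It is closed under partial derivatives, which
  gives smoothness by induction.\<close>

definition quadratic :: "'a::real_inner \<Rightarrow> real \<Rightarrow> 'a \<Rightarrow> real \<Rightarrow> 'a \<Rightarrow> real" where
  "quadratic a K p c x = K * (norm (x - a))\<^sup>2 + p \<bullet> (x - a) + c"

lemma has_derivative_quadratic:
  "(quadratic a K p c has_derivative (\<lambda>h. (2 * K) * ((x - a) \<bullet> h) + p \<bullet> h)) (at x)"
  unfolding quadratic_def power2_norm_eq_inner
  by (auto intro!: derivative_eq_intros simp: inner_commute algebra_simps)

lemma differentiable_quadratic: "quadratic a K p c differentiable (at x)"
  using has_derivative_quadratic unfolding differentiable_def by blast

lemma partial_deriv_quadratic:
  "partial_deriv i (quadratic a K p c) = quadratic a 0 (axis i (2 * K)) (p $ i)"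
  by (rule ext)
    (simp add: has_derivative_imp_partial_deriv[OF has_derivative_quadratic] quadratic_def
      inner_axis inner_axis' algebra_simps)

lemma Ck_on_quadratic: "Ck_on k S (quadratic a K p c)"
proof (induction k arbitrary: K p c)
  case 0
  show ?case by (auto simp: quadratic_def intro!: continuous_intros)
next
  case (Suc k)
  then show ?case
    by (auto simp: partial_deriv_quadratic differentiable_quadratic)
qed

lemma grad_quadratic: "grad (quadratic a K p c) x = (2 * K) *\<^sub>R (x - a) + p"
  by (simp add: grad_def partial_deriv_quadratic vec_eq_iff quadratic_def inner_axis' algebra_simps)

lemma hessian_quadratic: "hessian (quadratic a K p c) x = (2 * K) *\<^sub>R mat 1"
  by (simp add: hessian_def partial_deriv_quadratic vec_eq_iff quadratic_def mat_def axis_def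
      flip: zero_vec_def)

lemma grad_add_quadratic:
  assumes "Ck_on 2 V f" "x \<in> V"
  shows "grad (\<lambda>y. f y + quadratic a K p c y) x = grad f x + ((2 * K) *\<^sub>R (x - a) + p)"
  unfolding grad_quadratic[symmetric, where c = c] using C2_onD(1)[OF assms]
  by (simp add: grad_def partial_deriv_add differentiable_quadratic vec_eq_iff)

lemma hessian_add_quadratic:
  assumes f: "Ck_on 2 V f" and "open V" "x \<in> V"
  shows "hessian (\<lambda>y. f y + quadratic a K p c y) x = hessian f x + (2 * K) *\<^sub>R mat 1"
proof -
  let ?q = "quadratic a K p c"
  have q: "?q differentiable (at y)" "partial_deriv k ?q differentiable (at y)" for k y
    by (simp_all add: partial_deriv_quadratic differentiable_quadratic)
  note fV = C2_onD(1,2)[OF f]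
  have "partial_deriv i (partial_deriv j (\<lambda>y. f y + ?q y)) x
      = partial_deriv i (partial_deriv j f) x + partial_deriv i (partial_deriv j ?q) x" for i j
  proof -
    have "partial_deriv i (\<lambda>y. partial_deriv j f y + partial_deriv j ?q y) x
        = partial_deriv i (partial_deriv j (\<lambda>y. f y + ?q y)) x"
      by (rule partial_deriv_cong_open[OF \<open>open V\<close> \<open>x \<in> V\<close>])
        (simp_all add: fV q \<open>x \<in> V\<close> partial_deriv_add differentiable_add)
    then show ?thesis
      by (simp add: partial_deriv_add fV q \<open>x \<in> V\<close>)
  qed
  then show ?thesis
    unfolding hessian_quadratic[symmetric, of K a p c x] by (simp add: hessian_def vec_eq_iff)
qed

section \<open>Lower semicontinuity\<close>

lemma lsc_on_eventually:
  assumes "lsc_on S f" "x \<in> S" "c < f x"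
  obtains T where "open T" "x \<in> T" "\<And>y. y \<in> T \<Longrightarrow> y \<in> S \<Longrightarrow> c < f y"
  using assms unfolding lsc_on_def eventually_at_topological by metis

text \<open>If every \<open>x\<close> in \<open>K\<close> had a better point \<open>g x\<close>, then \<open>g x\<close> would remain better on a neighbourhood
  of \<open>x\<close>. The best of the finitely many \<open>g x\<close> that belong to a finite cover of \<open>K\<close> by such
  neighbourhoods lies itself in one of them, so another one of these points is better still.\<close>

lemma lsc_on_attains_min:
  assumes f: "lsc_on K f" and "compact K" "K \<noteq> {}"
  shows "\<exists>x\<in>K. \<forall>y\<in>K. f x \<le> f y"
proof (rule ccontr)
  assume "\<not> ?thesis"
  then obtain g where g: "\<And>x. x \<in> K \<Longrightarrow> g x \<in> K \<and> f (g x) < f x"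
    by (metis not_le)
  then have "\<exists>T. open T \<and> x \<in> T \<and> (\<forall>y\<in>T \<inter> K. f (g x) < f y)" if "x \<in> K" for x
    using lsc_on_eventually[OF f that] that by (metis IntE)
  then obtain T where T: "\<And>x. x \<in> K \<Longrightarrow> open (T x) \<and> x \<in> T x \<and> (\<forall>y\<in>T x \<inter> K. f (g x) < f y)"
    by metis
  then have cover: "K \<subseteq> (\<Union>x\<in>K. T x)"
    by auto
  obtain D where D: "D \<subseteq> K" "finite D" "K \<subseteq> (\<Union>x\<in>D. T x)"
    by (rule compactE_image[OF \<open>compact K\<close> _ cover]) (use T in auto)
  have "D \<noteq> {}" using D \<open>K \<noteq> {}\<close> by auto
  then obtain m where m: "m \<in> D" "\<And>x. x \<in> D \<Longrightarrow> f (g m) \<le> f (g x)"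
    using ex_is_arg_min_if_finite[OF \<open>finite D\<close>, of "\<lambda>x. f (g x)"]
    by (auto simp: is_arg_min_linorder)
  obtain x where "x \<in> D" "g m \<in> T x"
    using D(1,3) m(1) g[of m] by blast
  then have "f (g x) < f (g m)"
    using T[of x] D(1) g[of m] m(1) by blast
  then show False
    using m(2)[OF \<open>x \<in> D\<close>] by simp
qed

lemma lsc_on_diff_continuous:
  assumes f: "lsc_on S f" and g: "continuous_on S g"
  shows "lsc_on S (\<lambda>x. f x - g x)"
  unfolding lsc_on_def
proof (intro ballI allI impI)
  fix x c assume "x \<in> S" "c < f x - g x"
  define e where "e = (f x - g x - c) / 2"
  have "e > 0" using \<open>c < f x - g x\<close> by (simp add: e_def)
  have "\<forall>\<^sub>F y in at x within S. f x - e < f y"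
    using f \<open>x \<in> S\<close> \<open>e > 0\<close> by (simp add: lsc_on_def)
  moreover have "\<forall>\<^sub>F y in at x within S. g y < g x + e"
    using g \<open>x \<in> S\<close> \<open>e > 0\<close> by (auto simp: continuous_on_def intro: order_tendstoD)
  ultimately show "\<forall>\<^sub>F y in at x within S. c < f y - g y"
    by eventually_elim (auto simp: e_def field_simps)
qed

lemma lsc_on_subset: "lsc_on S f \<Longrightarrow> T \<subseteq> S \<Longrightarrow> lsc_on T f"
  unfolding lsc_on_def by (meson at_le filter_leD subsetD)

section \<open>No cone below a lowerconical function\<close>

text \<open>Near \<open>a\<close>, half of the cone absorbs the error of the linear approximation of \<open>\<phi>\<close>, so \<open>u\<close> minus the
  linear part \<open>p \<bullet> (x - a)\<close> still lies above a cone of slope \<open>m / 2\<close>. Away from \<open>a\<close>, \<open>u\<close> is bounded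
  below and \<open>\<Omega>\<close> is bounded, so adding a large multiple of \<open>|x - a|\<^sup>2\<close> makes the same estimate hold on
  all of \<open>\<Omega>\<close>. The resulting \<open>\<eta>\<close> is a quadratic polynomial although \<open>\<phi>\<close> is only differentiable at
  \<open>a\<close>.\<close>

lemma lowerconical_no_cone_above_test:
  assumes u: "lowerconical_at \<Omega> u a" and "bounded \<Omega>"
    and \<phi>: "\<phi> differentiable (at a)" "\<phi> a = u a" and "0 < m"
  shows "\<not> (\<forall>\<^sub>F x in nhds a. \<phi> x + m * norm (x - a) \<le> u x)"
proof
  assume cone: "\<forall>\<^sub>F x in nhds a. \<phi> x + m * norm (x - a) \<le> u x"
  obtain \<phi>' where \<phi>': "(\<phi> has_derivative \<phi>') (at a)"
    using \<phi> differentiable_def by blast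
  \<comment> \<open>The gradient of \<open>\<phi>\<close> at \<open>a\<close>, as the vector representing the linear form \<open>\<phi>'\<close>.\<close>
  define p where "p = adjoint \<phi>' 1"
  have p: "\<phi>' h = p \<bullet> h" for h
    using adjoint_works[OF has_derivative_linear[OF \<phi>'], of h 1]
    by (simp add: p_def inner_commute)
  have "\<exists>d>0. \<forall>y. norm (y - a) < d \<longrightarrow> norm (\<phi> y - \<phi> a - \<phi>' (y - a)) \<le> m / 2 * norm (y - a)"
    using \<phi>' half_gt_zero[OF \<open>0 < m\<close>] unfolding has_derivative_at_alt by blast
  then obtain d where d: "d > 0"
    "\<And>y. norm (y - a) < d \<Longrightarrow> \<bar>\<phi> y - \<phi> a - p \<bullet> (y - a)\<bar> \<le> m / 2 * norm (y - a)"
    by (auto simp: p)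
  obtain e where e: "e > 0" "\<And>x. dist x a < e \<Longrightarrow> \<phi> x + m * norm (x - a) \<le> u x"
    using cone unfolding eventually_nhds_metric by auto
  define r where "r = min d e"
  have "r > 0" using d e by (simp add: r_def)
  have near: "u a + p \<bullet> (x - a) + m / 2 * norm (x - a) \<le> u x" if "norm (x - a) < r" for x
  proof -
    have "\<bar>\<phi> x - \<phi> a - p \<bullet> (x - a)\<bar> \<le> m / 2 * norm (x - a)" "\<phi> x + m * norm (x - a) \<le> u x"
      using d(2)[of x] e(2)[of x] that by (auto simp: r_def dist_norm)
    moreover have "m * norm (x - a) = m / 2 * norm (x - a) + m / 2 * norm (x - a)"
      by (simp add: field_simps)
    ultimately show ?thesis
      using \<phi>(2) unfolding abs_le_iff by linarith
  qed
  have "(INF x\<in>\<Omega>. ereal (u x)) > -\<infinity>"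
    using u by (simp add: lowerconical_at_def)
  then obtain M where "ereal M < (INF x\<in>\<Omega>. ereal (u x))"
    using ereal_dense2 by blast
  then have M: "M \<le> u x" if "x \<in> \<Omega>" for x
    using less_INF_D[OF _ that] by force
  obtain B where B: "\<And>x. x \<in> \<Omega> \<Longrightarrow> norm (x - a) \<le> B"
    using bounded_any_center[of \<Omega> a] \<open>bounded \<Omega>\<close> by (auto simp: dist_norm norm_minus_commute)
  have "a \<in> \<Omega>" using u by (simp add: lowerconical_at_def)
  then have "B \<ge> 0" using B[of a] by simp
  \<comment> \<open>Large enough that \<open>K |x - a|\<^sup>2\<close> outweighs all other terms where \<open>|x - a| \<ge> r\<close>.\<close>
  define K where "K = (\<bar>M\<bar> + \<bar>u a\<bar> + norm p * B + m * B) / r\<^sup>2"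
  have "K \<ge> 0" using \<open>B \<ge> 0\<close> \<open>m > 0\<close> by (simp add: K_def)
  let ?\<eta> = "quadratic a K (- p) 0"
  have "0 \<le> (u x + ?\<eta> x) - (u a + ?\<eta> a) - m / 2 * norm (x - a)" if "x \<in> \<Omega>" for x
  proof (cases "norm (x - a) < r")
    case True
    then show ?thesis
      using near[OF True] mult_nonneg_nonneg[OF \<open>K \<ge> 0\<close> zero_le_power2[of "norm (x - a)"]]
      by (simp add: quadratic_def)
  next
    case False
    have "\<bar>M\<bar> + \<bar>u a\<bar> + norm p * B + m * B = K * r\<^sup>2"
      using \<open>r > 0\<close> by (simp add: K_def)
    also have "\<dots> \<le> K * (norm (x - a))\<^sup>2"
      using False \<open>r > 0\<close> \<open>K \<ge> 0\<close> by (intro mult_left_mono power_mono) auto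
    finally have "\<bar>M\<bar> + \<bar>u a\<bar> + norm p * B + m * B \<le> K * (norm (x - a))\<^sup>2" .
    moreover have "p \<bullet> (x - a) \<le> norm p * B"
      using norm_cauchy_schwarz[of p "x - a"] B[OF that]
      by (meson mult_left_mono norm_ge_zero order_trans)
    moreover have "m * norm (x - a) \<le> m * B"
      using B[OF that] \<open>m > 0\<close> by simp
    moreover have "0 \<le> m * norm (x - a)"
      using \<open>m > 0\<close> by simp
    ultimately show ?thesis
      using M[OF that] by (simp add: quadratic_def)
  qed
  then have "0 \<le> (INF x\<in>\<Omega>. ereal ((u x + ?\<eta> x) - (u a + ?\<eta> a) - m / 2 * norm (x - a)))"
    by (intro INF_greatest) simp
  moreover have "smooth_fun_on \<Omega> ?\<eta>"
    by (simp add: smooth_fun_on_def Ck_on_quadratic)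
  ultimately show False
    using u \<open>m > 0\<close> unfolding lowerconical_at_def by (meson half_gt_zero not_le)
qed

section \<open>Contact points of tilted test functions\<close>

text \<open>A linear tilt in the direction of a point \<open>z\<close> at which the cone is not below \<open>u\<close> reproduces the value
  of the cone at \<open>z\<close>, so \<open>u\<close> minus the tilted function has a negative minimum. At its minimum point
  \<open>x\<close>, negativity and \<open>\<phi> \<le> u\<close> give \<open>d |x - a|\<^sup>2 < p \<bullet> (x - a) \<le> d\<^sup>2 |x - a|\<close>. The bound \<open>d\<^sup>2\<close> on the tilt
  is chosen to make this say \<open>0 < |x - a| < d\<close>.\<close>

lemma tilted_contact_point:
  fixes a :: "'a::euclidean_space"
  assumes u: "lsc_on (cball a r) u" and \<phi>: "continuous_on (cball a r) \<phi>"
    and below: "\<And>x. x \<in> cball a r \<Longrightarrow> \<phi> x \<le> u x"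
    and "0 < d" "d \<le> r"
    and no_cone: "\<not> (\<forall>x\<in>cball a r. \<phi> x - d * (norm (x - a))\<^sup>2 + d\<^sup>2 * norm (x - a) \<le> u x)"
  obtains x p c where "x \<in> ball a d" "x \<noteq> a" "norm p \<le> d\<^sup>2" "u x \<le> \<phi> x + d ^ 3"
    "u x = \<phi> x + quadratic a (- d) p c x"
    "\<And>y. y \<in> cball a r \<Longrightarrow> \<phi> y + quadratic a (- d) p c y \<le> u y"
proof -
  obtain z where z: "z \<in> cball a r" "u z < \<phi> z - d * (norm (z - a))\<^sup>2 + d\<^sup>2 * norm (z - a)"
    using no_cone by (auto simp: not_le)
  define p where "p = d\<^sup>2 *\<^sub>R sgn (z - a)"
  have np: "norm p \<le> d\<^sup>2" by (simp add: p_def norm_sgn)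
  have "p \<bullet> (z - a) = d\<^sup>2 * norm (z - a)"
    by (cases "z = a")
      (simp_all add: p_def sgn_div_norm power2_norm_eq_inner[symmetric] power2_eq_square)
  define w where "w y = u y - (\<phi> y + quadratic a (- d) p 0 y)" for y
  have "w z < 0"
    using z \<open>p \<bullet> (z - a) = _\<close> by (simp add: w_def quadratic_def)
  have "continuous_on (cball a r) (\<lambda>y. \<phi> y + quadratic a (- d) p 0 y)"
    unfolding quadratic_def by (intro continuous_intros \<phi>)
  then have "lsc_on (cball a r) w"
    unfolding w_def by (rule lsc_on_diff_continuous[OF u])
  then obtain x where x: "x \<in> cball a r" "\<And>y. y \<in> cball a r \<Longrightarrow> w x \<le> w y"
    using lsc_on_attains_min[OF _ compact_cball, of a r w] z(1) by blast
  then have "w x < 0" using \<open>w z < 0\<close> z by force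
  have pxa: "p \<bullet> (x - a) \<le> d\<^sup>2 * norm (x - a)"
    using norm_cauchy_schwarz[of p "x - a"] np
    by (meson mult_right_mono norm_ge_zero order_trans)
  have "x \<noteq> a"
    using \<open>w x < 0\<close> below[OF x(1)] by (auto simp: w_def quadratic_def)
  have "d * (norm (x - a))\<^sup>2 < d\<^sup>2 * norm (x - a)"
    using \<open>w x < 0\<close> below[OF x(1)] pxa by (simp add: w_def quadratic_def)
  then have "norm (x - a) < d"
    using \<open>x \<noteq> a\<close> \<open>0 < d\<close> by (simp add: power2_eq_square)
  have "u x \<le> \<phi> x + d\<^sup>2 * norm (x - a)"
  proof -
    have "0 \<le> d * (norm (x - a))\<^sup>2" using \<open>0 < d\<close> by simp
    then show ?thesis
      using \<open>w x < 0\<close> pxa unfolding w_def quadratic_def by linarith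
  qed
  also have "\<dots> \<le> \<phi> x + d ^ 3"
    using \<open>norm (x - a) < d\<close> \<open>0 < d\<close> by (simp add: power2_eq_square power3_eq_cube)
  finally have "u x \<le> \<phi> x + d ^ 3" .
  show thesis
  proof
    show "x \<in> ball a d"
      using \<open>norm (x - a) < d\<close> by (simp add: dist_norm norm_minus_commute)
    show "u x = \<phi> x + quadratic a (- d) p (w x) x"
      by (simp add: w_def quadratic_def)
    show "\<phi> y + quadratic a (- d) p (w x) y \<le> u y" if "y \<in> cball a r" for y
      using x(2)[OF that] by (simp add: w_def quadratic_def)
  qed fact+
qed

section \<open>The removable singularity theorem\<close>

lemma visc_supersolD:
  assumes "visc_supersol U F f u" "x \<in> U" "open V" "x \<in> V" "Ck_on 2 V \<phi>"
    and "\<forall>\<^sub>F y in nhds x. \<phi> y \<le> u y" "\<phi> x = u x"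
  shows "F x (\<phi> x) (grad \<phi> x) (hessian \<phi> x) \<le> f x"
  using assms unfolding visc_supersol_def by blast

theorem theorem1p1:
  fixes \<Omega> :: "(real^'n::finite) set"
    and a :: "real^'n"
    and F :: "real^'n \<Rightarrow> real \<Rightarrow> real^'n \<Rightarrow> real^'n^'n \<Rightarrow> real"
    and u f :: "real^'n \<Rightarrow> real"
  assumes "bounded \<Omega>" and "connected \<Omega>" and "open \<Omega>"
    and "a \<in> \<Omega>"
    and "continuous_on (\<Omega> \<times> UNIV \<times> UNIV \<times> sym_matrices) (\<lambda>(x, r, p, M). F x r p M)"
    and "lsc_on \<Omega> u"
    and "lowerconical_at \<Omega> u a"
    and "usc_on \<Omega> f"
    and "visc_supersol (\<Omega> - {a}) F f u"
  shows "visc_supersol \<Omega> F f u"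
  unfolding visc_supersol_def
proof (intro allI impI)
  fix x\<^sub>0 \<phi>
  assume "x\<^sub>0 \<in> \<Omega>" and C2: "\<exists>V. open V \<and> x\<^sub>0 \<in> V \<and> Ck_on 2 V \<phi>"
    and le: "\<forall>\<^sub>F x in nhds x\<^sub>0. \<phi> x \<le> u x" and eq: "\<phi> x\<^sub>0 = u x\<^sub>0"
  show "F x\<^sub>0 (\<phi> x\<^sub>0) (grad \<phi> x\<^sub>0) (hessian \<phi> x\<^sub>0) \<le> f x\<^sub>0"
  proof (cases "x\<^sub>0 = a")
    case False
    then show ?thesis
      using assms(9) \<open>x\<^sub>0 \<in> \<Omega>\<close> C2 le eq unfolding visc_supersol_def by blast
  next
    case True
    obtain V where V: "open V" "a \<in> V" and \<phi>: "Ck_on 2 V \<phi>"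
      using C2 True by auto
    obtain W where W: "open W" "a \<in> W" "\<And>x. x \<in> W \<Longrightarrow> \<phi> x \<le> u x"
      using le True unfolding eventually_nhds by blast
    obtain r where r: "r > 0" "cball a r \<subseteq> V \<inter> W \<inter> \<Omega>"
      using open_contains_cball[of "V \<inter> W \<inter> \<Omega>"] V W \<open>open \<Omega>\<close> \<open>a \<in> \<Omega>\<close> by blast
    \<comment> \<open>The quadratic coefficient and the tilt are sent to zero together, along one sequence.\<close>
    define d where "d n = r / real (Suc n)" for n
    have d: "0 < d n" "d n \<le> r" for n
      using r by (auto simp: d_def field_simps)
    have "(\<lambda>n. r * inverse (real (Suc n))) \<longlonglongrightarrow> r * 0"
      by (intro tendsto_intros LIMSEQ_inverse_real_of_nat)
    then have d0: "d \<longlonglongrightarrow> 0"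
      by (simp add: d_def[abs_def] divide_inverse)
    have "\<exists>x p. x \<in> ball a (d n) \<and> x \<noteq> a \<and> norm p \<le> (d n)\<^sup>2 \<and> u x \<le> \<phi> x + d n ^ 3 \<and>
      F x (u x) (grad \<phi> x + ((2 * - d n) *\<^sub>R (x - a) + p)) (hessian \<phi> x + (2 * - d n) *\<^sub>R mat 1) \<le> f x"
      for n
    proof -
      have "\<not> (\<forall>\<^sub>F x in nhds a. \<phi> x + quadratic a (- d n) 0 0 x + (d n)\<^sup>2 * norm (x - a) \<le> u x)"
        using d(1)[of n] eq True
        by (intro lowerconical_no_cone_above_test[OF assms(7,1)] differentiable_add
            C2_onD(1)[OF \<phi> V(2)] differentiable_quadratic)
          (auto simp: quadratic_def)
      then have "\<not> (\<forall>x\<in>cball a r. \<phi> x - d n * (norm (x - a))\<^sup>2 + (d n)\<^sup>2 * norm (x - a) \<le> u x)"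
        using r(1) unfolding eventually_nhds_metric quadratic_def
        by (force simp: dist_commute)
      moreover have "lsc_on (cball a r) u"
        using lsc_on_subset[OF assms(6)] r by blast
      moreover have "continuous_on (cball a r) \<phi>"
        using continuous_on_subset[OF C2_continuous_on(1)[OF \<phi>]] r by blast
      moreover have "\<phi> x \<le> u x" if "x \<in> cball a r" for x
        using W(3) r that by blast
      ultimately obtain x p c where x: "x \<in> ball a (d n)" "x \<noteq> a" "norm p \<le> (d n)\<^sup>2" "u x \<le> \<phi> x + d n ^ 3"
        and touch: "u x = \<phi> x + quadratic a (- d n) p c x"
        and under: "\<And>y. y \<in> cball a r \<Longrightarrow> \<phi> y + quadratic a (- d n) p c y \<le> u y"
        using tilted_contact_point[OF _ _ _ d] by metis
      have xr: "x \<in> ball a r" "x \<in> cball a r" using x(1) d(2)[of n] by auto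
      then have "x \<in> V" "x \<in> \<Omega>" using r by auto
      let ?\<psi> = "\<lambda>y. \<phi> y + quadratic a (- d n) p c y"
      have "Ck_on 2 V ?\<psi>"
        by (intro Ck_on_add V \<phi> Ck_on_quadratic)
      moreover have "\<forall>\<^sub>F y in nhds x. ?\<psi> y \<le> u y"
        using eventually_nhds_in_open[OF open_ball xr(1)] under by (auto elim: eventually_mono)
      ultimately have "F x (?\<psi> x) (grad ?\<psi> x) (hessian ?\<psi> x) \<le> f x"
        using \<open>x \<in> \<Omega>\<close> x(2) touch
        by (intro visc_supersolD[OF assms(9) _ V(1) \<open>x \<in> V\<close>]) auto
      then show ?thesis
        unfolding grad_add_quadratic[OF \<phi> \<open>x \<in> V\<close>] hessian_add_quadratic[OF \<phi> V(1) \<open>x \<in> V\<close>]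
          touch[symmetric]
        using x by blast
    qed
    then obtain X P where X: "\<And>n. X n \<in> ball a (d n)" "\<And>n. X n \<noteq> a"
      and P: "\<And>n. norm (P n) \<le> (d n)\<^sup>2" and uX: "\<And>n. u (X n) \<le> \<phi> (X n) + d n ^ 3"
      and FX: "\<And>n. F (X n) (u (X n)) (grad \<phi> (X n) + ((2 * - d n) *\<^sub>R (X n - a) + P n))
          (hessian \<phi> (X n) + (2 * - d n) *\<^sub>R mat 1) \<le> f (X n)"
      by metis
    have Xr: "X n \<in> V \<inter> W \<inter> \<Omega>" for n
      using X(1)[of n] d(2)[of n] r by (meson ball_subset_cball subset_ball subsetD)
    have Xa: "X \<longlonglongrightarrow> a"
      using tendsto_of_shrinking_cballs[OF _ d0] X(1) ball_subset_cball by blast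
    have P0: "P \<longlonglongrightarrow> 0"
    proof (rule Lim_null_comparison)
      show "(\<lambda>n. (d n)\<^sup>2) \<longlonglongrightarrow> 0"
        using tendsto_power[OF d0, of 2] by simp
    qed (simp add: P)
    have lim: "(\<lambda>n. g (X n)) \<longlonglongrightarrow> g a" if "continuous_on V g" for g :: "_ \<Rightarrow> 'b::topological_space"
      using Xr by (intro continuous_on_tendsto_compose[OF that Xa V(2)]) simp
    note \<phi>_lim = C2_continuous_on[OF \<phi>, THEN lim]
    have u_lim: "(\<lambda>n. u (X n)) \<longlonglongrightarrow> \<phi> a"
    proof (rule tendsto_sandwich[OF _ _ \<phi>_lim(1)])
      show "(\<lambda>n. \<phi> (X n) + d n ^ 3) \<longlonglongrightarrow> \<phi> a"
        using tendsto_add[OF \<phi>_lim(1) tendsto_power[OF d0, of 3]] by simp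
    qed (use uX Xr W(3) in auto)
    have grad_lim: "(\<lambda>n. grad \<phi> (X n) + ((2 * - d n) *\<^sub>R (X n - a) + P n)) \<longlonglongrightarrow> grad \<phi> a"
    proof -
      have "(\<lambda>n. grad \<phi> (X n) + ((2 * - d n) *\<^sub>R (X n - a) + P n))
          \<longlonglongrightarrow> grad \<phi> a + ((2 * - 0) *\<^sub>R (a - a) + 0)"
        by (intro tendsto_intros \<phi>_lim d0 Xa P0)
      then show ?thesis by simp
    qed
    have hessian_lim: "(\<lambda>n. hessian \<phi> (X n) + (2 * - d n) *\<^sub>R mat 1) \<longlonglongrightarrow> hessian \<phi> a"
    proof -
      have "(\<lambda>n. hessian \<phi> (X n) + (2 * - d n) *\<^sub>R mat 1) \<longlonglongrightarrow> hessian \<phi> a + (2 * - 0) *\<^sub>R mat 1"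
        by (intro tendsto_intros \<phi>_lim d0)
      then show ?thesis by simp
    qed
    have sym: "hessian \<phi> (X n) + (2 * - d n) *\<^sub>R mat 1 \<in> sym_matrices" for n
      using hessian_symmetric[OF \<phi> V(1), of "X n"] Xr[of n]
      by (simp add: sym_matrices_def transpose_def mat_def vec_eq_iff)
    have F_lim: "(\<lambda>n. F (X n) (u (X n)) (grad \<phi> (X n) + ((2 * - d n) *\<^sub>R (X n - a) + P n))
          (hessian \<phi> (X n) + (2 * - d n) *\<^sub>R mat 1)) \<longlonglongrightarrow> F a (\<phi> a) (grad \<phi> a) (hessian \<phi> a)"
      using continuous_on_tendsto_compose[OF assms(5)
          tendsto_Pair[OF Xa tendsto_Pair[OF u_lim tendsto_Pair[OF grad_lim hessian_lim]]]]
        hessian_symmetric[OF \<phi> V] \<open>a \<in> \<Omega>\<close> Xr sym by simp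
    \<comment> \<open>Upper semicontinuity of \<open>f\<close>, tested against every level above \<open>f a\<close>.\<close>
    have "F a (\<phi> a) (grad \<phi> a) (hessian \<phi> a) \<le> c" if "f a < c" for c
    proof (rule tendsto_upperbound[OF F_lim])
      have "filterlim X (at a within \<Omega>) sequentially"
        using Xa X(2) Xr by (auto simp: filterlim_at intro!: always_eventually)
      moreover have "\<forall>\<^sub>F x in at a within \<Omega>. f x < c"
        using assms(8) \<open>a \<in> \<Omega>\<close> that by (simp add: usc_on_def)
      ultimately have "\<forall>\<^sub>F n in sequentially. f (X n) < c"
        using eventually_compose_filterlim by blast
      then show "\<forall>\<^sub>F n in sequentially. F (X n) (u (X n)) (grad \<phi> (X n) + ((2 * - d n) *\<^sub>R (X n - a) + P n))
          (hessian \<phi> (X n) + (2 * - d n) *\<^sub>R mat 1) \<le> c"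
        by (rule eventually_mono) (use FX in \<open>meson less_imp_le order_trans\<close>)
    qed simp
    then show ?thesis
      using dense_ge True by blast
  qed
qed

end
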